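(* Let $K=\mathbb{Q}(\sqrt{D})$ where $D\in\mathbb{Z}_{\ge2}$ is squarefree. (i) There exists $\alpha\in\mathcal{O}_K^+$ such that $p_K(\alpha)=4$. (ii) If $\lceil\xi_D\rceil-\xi_D>\frac12$, then there exists $\alpha\in\mathcal{O}_K^+$ such that $p_K(\alpha)=6$.
   Context: $\mathcal{O}_K$ is the ring of integers of $K$ and $\mathcal{O}_K^+$ is the set of totally positive elements of $\mathcal{O}_K$ (elements $\gamma$ with $\gamma>0$ and $\gamma'>0$, where $'$ denotes Galois conjugation). A partition of $\alpha\in\mathcal{O}_K^+$ is an expression $\alpha=\alpha_1+\dots+\alpha_k$ with $k\ge1$ and all $\alpha_i\in\mathcal{O}_K^+$, the order of the summands being irrelevant; $p_K(\alpha)$ is the number of partitions of $\alpha$. Define $\xi_D=\sqrt{D}$ if $D\equiv2,3\pmod4$ and $\xi_D=\frac{\sqrt{D}-1}{2}$ if $D\equiv1\pmod4$. *)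

theory Defs
  imports
    "HOL-Library.Multiset"
    "HOL-Computational_Algebra.Computational_Algebra"
begin

text \<open>The field K is realised inside the reals, via the embedding sending the square root of D
  to the positive real root.\<close>

definition quad_field :: "int \<Rightarrow> real set" where
  "quad_field D = {a + b * sqrt (of_int D) | a b. a \<in> \<rat> \<and> b \<in> \<rat>}"

text \<open>Galois conjugation on K. The description determines a unique value whenever the square root
  of D is irrational (lemma \<open>quad_conj_eq\<close>); outside K the value is irrelevant.\<close>

definition quad_conj :: "int \<Rightarrow> real \<Rightarrow> real" where
  "quad_conj D x =
    (THE y. \<exists>a\<in>\<rat>. \<exists>b\<in>\<rat>. x = a + b * sqrt (of_int D) \<and> y = a - b * sqrt (of_int D))"

definition ring_of_ints :: "int \<Rightarrow> real set" where
  "ring_of_ints D = {x \<in> quad_field D. algebraic_int x}"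

definition tot_pos_ints :: "int \<Rightarrow> real set" where
  "tot_pos_ints D = {x \<in> ring_of_ints D. x > 0 \<and> quad_conj D x > 0}"

definition partitions_of :: "int \<Rightarrow> real \<Rightarrow> real multiset set" where
  "partitions_of D \<alpha> = {M. M \<noteq> {#} \<and> set_mset M \<subseteq> tot_pos_ints D \<and> sum_mset M = \<alpha>}"

text \<open>The cardinality of an infinite set is 0, so a positive value of the partition
  function entails that the set of partitions is finite.\<close>

definition num_partitions :: "int \<Rightarrow> real \<Rightarrow> nat" where
  "num_partitions D \<alpha> = card (partitions_of D \<alpha>)"

definition xi :: "int \<Rightarrow> real" where
  "xi D = (if D mod 4 = 1 then (sqrt (of_int D) - 1) / 2 else sqrt (of_int D))"

lemma sqrt_squarefree_irrational:
  fixes D :: int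
  assumes "squarefree D" "D \<ge> 2"
  shows "sqrt (of_int D) \<notin> \<rat>"
proof
  assume "sqrt (of_int D) \<in> \<rat>"
  moreover have "algebraic_int (sqrt (of_int D))"
    by (intro algebraic_int_sqrt algebraic_int_of_int)
  ultimately have "sqrt (of_int D) \<in> \<int>"
    by (rule rational_algebraic_int_is_int[rotated])
  then obtain z :: int where z: "sqrt (of_int D) = of_int z"
    by (elim Ints_cases)
  have "real_of_int D = (sqrt (of_int D))\<^sup>2"
    using assms by simp
  also have "\<dots> = of_int (z\<^sup>2)"
    by (simp add: z)
  finally have D: "D = z\<^sup>2"
    by (simp only: of_int_eq_iff)
  then have "z dvd 1"
    using squarefreeD[OF assms(1), of z] by (metis dvd_refl)
  then have "D dvd 1"
    unfolding D by (simp add: is_unit_power_iff abs_square_eq_1)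
  then have "D \<le> 1"
    by (rule zdvd_imp_le) simp
  with assms show False
    by simp
qed

lemma quad_conj_eq:
  fixes D :: int
  assumes "squarefree D" "D \<ge> 2" "a \<in> \<rat>" "b \<in> \<rat>"
  shows "quad_conj D (a + b * sqrt (of_int D)) = a - b * sqrt (of_int D)"
  unfolding quad_conj_def
proof (rule the_equality)
  fix y
  assume "\<exists>a'\<in>\<rat>. \<exists>b'\<in>\<rat>. a + b * sqrt (of_int D) = a' + b' * sqrt (of_int D)
            \<and> y = a' - b' * sqrt (of_int D)"
  then obtain a' b' where r: "a' \<in> \<rat>" "b' \<in> \<rat>"
    and e: "a + b * sqrt (of_int D) = a' + b' * sqrt (of_int D)"
    and y: "y = a' - b' * sqrt (of_int D)" by blast
  have "b = b'"
  proof (rule ccontr)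
    assume "b \<noteq> b'"
    with e have "sqrt (of_int D) = (a' - a) / (b - b')"
      by (simp add: field_simps)
    also have "\<dots> \<in> \<rat>"
      using r assms by (intro Rats_divide Rats_diff)
    finally show False
      using sqrt_squarefree_irrational[OF assms(1,2)] by simp
  qed
  with e y show "y = a - b * sqrt (of_int D)"
    by simp
qed (use assms in blast)

end

theory Submission
  imports Defs "HOL-Library.Product_Plus"
begin

text \<open>Write the integers of K as \<open>a + b\<omega>\<close> with conjugate \<open>a - b\<xi>\<close>, where \<open>\<xi> = xi D\<close> and
  \<open>\<omega>\<close> is \<open>\<xi>\<close> or \<open>\<xi> + 1\<close>, and put \<open>n = \<lceil>\<xi>\<rceil>\<close>. A totally positive integer with \<open>b < 0\<close> has a
  larger conjugate than \<open>\<alpha> = (n + 2) + \<omega>\<close> and, when \<open>n - \<xi> > 1/2\<close>, than \<open>\<beta> = (2n + 1) + 2\<omega>\<close>,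
  so all parts of \<open>\<alpha>\<close> and \<open>\<beta>\<close> have \<open>b \<ge> 0\<close>.
  As the least totally positive integers with \<open>b = 0, 1\<close> are \<open>1\<close> and \<open>n + \<omega>\<close>, and the
  least one with \<open>b = 2\<close> is \<open>(2n - 1) + 2\<omega>\<close> when \<open>n - \<xi> > 1/2\<close>, the partitions can be listed.\<close>

section \<open>Integers of a real quadratic field\<close>

text \<open>The usual generator, the square root of \<open>D\<close> or half of one plus it. Written
  through \<open>xi D\<close>, it has conjugate \<open>- xi D\<close>.\<close>

definition quad_omega :: "int \<Rightarrow> real" where
  "quad_omega D = xi D + (if D mod 4 = 1 then 1 else 0)"

section \<open>Integrality of trace and norm\<close>

lemma poly_map_poly_of_int [simp]:
  fixes x :: "'a :: comm_ring_1"
  shows "poly (map_poly of_int (p + q)) x = poly (map_poly of_int p) x + poly (map_poly of_int q) x"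
    and "poly (map_poly of_int (p * q)) x = poly (map_poly of_int p) x * poly (map_poly of_int q) x"
    and "poly (map_poly of_int (smult c p)) x = of_int c * poly (map_poly of_int p) x"
proof -
  show add: "poly (map_poly of_int (p + q)) x = poly (map_poly of_int p) x + poly (map_poly of_int q) x" for p q
  proof -
    have "map_poly of_int (p + q) = map_poly of_int p + (map_poly of_int q :: 'a poly)"
      by (simp add: poly_eq_iff coeff_map_poly)
    then show ?thesis by simp
  qed
  show smult: "poly (map_poly of_int (smult c p)) x = of_int c * poly (map_poly of_int p) x" for c p
  proof -
    have "map_poly of_int (smult c p) = smult (of_int c) (map_poly of_int p :: 'a poly)"
      by (simp add: poly_eq_iff coeff_map_poly)
    then show ?thesis by simp
  qed
  show "poly (map_poly of_int (p * q)) x = poly (map_poly of_int p) x * poly (map_poly of_int q) x"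
    by (induction p) (auto simp: add smult map_poly_pCons algebra_simps)
qed

text \<open>Gauss's lemma: a monic integer polynomial vanishing at \<open>x\<close> is, up to a constant, a multiple of
  the primitive quadratic \<open>q\<close>, and comparing contents this constant can be removed.\<close>

lemma algebraic_int_primitive_quadratic:
  fixes x :: real and q :: "int poly"
  assumes x: "algebraic_int x" "x \<notin> \<rat>"
    and q: "content q = 1" "degree q = 2" "poly (map_poly of_int q) x = 0"
  shows "lead_coeff q dvd 1"
proof -
  from x(1) obtain p where p: "poly (map_poly of_int p) x = 0" "lead_coeff p = 1"
    by (auto simp: algebraic_int_altdef_ipoly)
  have "q \<noteq> 0" using q by auto
  define r where "r = pseudo_mod p q"
  from pseudo_mod[OF \<open>q \<noteq> 0\<close>, of p] obtain a h
    where ah: "a \<noteq> 0" "smult a p = q * h + r" and r: "r = 0 \<or> degree r < 2"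
    unfolding r_def q(2) by blast
  have "r = [:coeff r 0, coeff r 1:]"
    using r by (auto simp: poly_eq_iff coeff_pCons coeff_eq_0 split: nat.splits)
  then obtain c d where cd: "r = [:c, d:]" by blast
  have "poly (map_poly of_int (smult a p)) x = poly (map_poly of_int (q * h + r)) x"
    using ah by simp
  then have "poly (map_poly of_int r) x = 0" using p q by simp
  then have root: "of_int c + x * of_int d = 0" by (simp add: cd map_poly_pCons)
  \<comment> \<open>An irrational number is not a root of a nonzero linear integer polynomial, so
    the pseudo-remainder vanishes.\<close>
  have "d = 0"
  proof (rule ccontr)
    assume "d \<noteq> 0"
    then have "x = - of_int c / of_int d" using root by (simp add: field_simps)
    also have "\<dots> \<in> \<rat>" by simp
    finally show False using x(2) by simp
  qed
  with root cd ah have eq: "smult a p = q * h" by simp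
  have "content p dvd lead_coeff p" by (rule content_dvd_coeff)
  then have "content p = 1" using p(2) normalize_content[of p] by (simp add: is_unit_normalize)
  then have "content h = \<bar>a\<bar>"
    using arg_cong[OF eq, of content] q(1) by (simp add: content_mult)
  then have "h = smult \<bar>a\<bar> (primitive_part h)" using content_times_primitive_part[of h] by simp
  then have "lead_coeff h = \<bar>a\<bar> * lead_coeff (primitive_part h)" by (metis lead_coeff_smult)
  then have "a = lead_coeff q * (\<bar>a\<bar> * lead_coeff (primitive_part h))"
    using arg_cong[OF eq, of lead_coeff] p(2) by (simp only: lead_coeff_mult lead_coeff_smult mult_1_right)
  then have "\<bar>a\<bar> * (lead_coeff q * lead_coeff (primitive_part h) * sgn a) = \<bar>a\<bar> * 1"
    by (metis abs_sgn mult.assoc mult.commute mult.right_neutral)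
  then have "lead_coeff q * (lead_coeff (primitive_part h) * sgn a) = 1"
    using ah(1) by (simp add: mult.assoc)
  then show ?thesis by (metis dvd_triv_left)
qed

text \<open>For \<open>b = 0\<close> this is integrality of a rational algebraic integer. Otherwise
  the element is irrational and a root of a primitive integer quadratic; the leading coefficient is
  a unit, so the monic version is integral, and its coefficients are the norm and minus the
  trace.\<close>

lemma algebraic_int_trace_norm:
  fixes D :: int and a b :: real
  assumes D: "squarefree D" "D \<ge> 2" and ab: "a \<in> \<rat>" "b \<in> \<rat>"
    and x: "algebraic_int (a + b * sqrt (of_int D))"
  shows "2 * a \<in> \<int>" "a\<^sup>2 - of_int D * b\<^sup>2 \<in> \<int>"
proof -
  let ?s = "sqrt (of_int D)" and ?x = "a + b * sqrt (of_int D)"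
  have "?s * ?s = of_int D" using D by simp
  \<comment> \<open>With \<open>D\<close> written as \<open>r * r\<close>, identities involving the
    square root become polynomial identities in \<open>r\<close>.\<close>
  then obtain r where r: "?s = r" "of_int D = r * r" by metis
  have irr: "v = 0" if "u \<in> \<rat>" "v \<in> \<rat>" "u + v * ?s = 0" for u v
  proof (rule ccontr)
    assume "v \<noteq> 0"
    then have "?s = - u / v" using that by (simp add: field_simps)
    also have "\<dots> \<in> \<rat>" using that by simp
    finally show False using sqrt_squarefree_irrational[OF D] by simp
  qed
  have "2 * a \<in> \<int> \<and> a\<^sup>2 - of_int D * b\<^sup>2 \<in> \<int>"
  proof (cases "b = 0")
    case True
    then have "a \<in> \<int>" using x ab by (intro rational_algebraic_int_is_int) auto
    then show ?thesis using True by simp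
  next
    case False
    have "?x \<notin> \<rat>"
    proof
      assume "?x \<in> \<rat>"
      then have "b = 0" using irr[OF Rats_diff[OF ab(1) \<open>?x \<in> \<rat>\<close>] ab(2)] by simp
      with False show False by simp
    qed
    obtain m n where mn: "n > 0" "a = of_int m / of_int n" using ab(1) by (elim Rats_cases')
    obtain k l where kl: "l > 0" "b = of_int k / of_int l" using ab(2) by (elim Rats_cases')
    \<comment> \<open>This is \<open>X^2 - 2 a X + (a^2 - D b^2)\<close> multiplied by
      \<open>n^2 l^2\<close> to clear denominators.\<close>
    define q0 where "q0 = [:m\<^sup>2 * l\<^sup>2 - D * k\<^sup>2 * n\<^sup>2, - 2 * m * n * l\<^sup>2, n\<^sup>2 * l\<^sup>2:]"
    define q where "q = primitive_part q0"
    have q0: "q0 \<noteq> 0" "degree q0 = 2" using mn kl by (auto simp: q0_def)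
    have q0_q: "q0 = smult (content q0) q" by (simp add: q_def)
    have "poly (map_poly of_int q0) ?x = of_int (n\<^sup>2 * l\<^sup>2) * (?x\<^sup>2 - 2 * a * ?x + (a\<^sup>2 - of_int D * b\<^sup>2))"
    proof -
      have "of_int m = a * of_int n" "of_int k = b * of_int l" using mn kl by auto
      then show ?thesis by (simp add: q0_def map_poly_pCons power2_eq_square algebra_simps)
    qed
    also have "?x\<^sup>2 - 2 * a * ?x + (a\<^sup>2 - of_int D * b\<^sup>2) = 0"
      unfolding r(1) unfolding r(2) by (simp add: power2_eq_square algebra_simps)
    finally have "poly (map_poly of_int q0) ?x = 0" by simp
    then have root: "poly (map_poly of_int q) ?x = 0"
      using q0 by (subst (asm) q0_q) simp
    have deg: "degree q = 2" using q0 by (simp add: q_def)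
    have "content q = 1" using q0 by (simp add: q_def)
    from algebraic_int_primitive_quadratic[OF x \<open>?x \<notin> \<rat>\<close> this deg root]
    have unit: "lead_coeff q dvd 1" .
    \<comment> \<open>Since \<open>e\<close> is \<open>1\<close> or \<open>-1\<close>, multiplying
      by it makes \<open>q\<close> monic.\<close>
    define e where "e = lead_coeff q"
    have e: "e * e = 1" using unit unfolding e_def by (auto simp: zdvd1_eq abs_if split: if_splits)
    have "smult e q = [:e * coeff q 0, e * coeff q 1, 1:]"
      using deg e by (auto simp: poly_eq_iff coeff_pCons coeff_eq_0 e_def numeral_2_eq_2 split: nat.splits)
    then obtain u v where "smult e q = [:u, v, 1:]" by blast
    moreover have "poly (map_poly of_int (smult e q)) ?x = 0" using root by simp
    ultimately have uv: "?x\<^sup>2 + of_int v * ?x + of_int u = 0"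
      by (simp add: map_poly_pCons power2_eq_square algebra_simps)
    \<comment> \<open>Separate the rational part from the multiple of the square root: both must
      vanish, which determines first \<open>v\<close> and then \<open>u\<close>.\<close>
    have "(a\<^sup>2 + of_int D * b\<^sup>2 + of_int v * a + of_int u) + (2 * a + of_int v) * b * ?s =
        ?x\<^sup>2 + of_int v * ?x + of_int u"
      unfolding r(1) unfolding r(2) by (simp add: power2_eq_square algebra_simps)
    with uv have *: "(a\<^sup>2 + of_int D * b\<^sup>2 + of_int v * a + of_int u) + (2 * a + of_int v) * b * ?s = 0"
      by simp
    then have "(2 * a + of_int v) * b = 0" by (rule irr[rotated 2]) (use ab in auto)
    then have v: "of_int v = - 2 * a" using False by simp
    with * have "a\<^sup>2 - of_int D * b\<^sup>2 = of_int u" by (simp add: power2_eq_square algebra_simps)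
    moreover have "2 * a = of_int (- v)" using v by simp
    ultimately show ?thesis by (metis Ints_of_int)
  qed
  then show "2 * a \<in> \<int>" "a\<^sup>2 - of_int D * b\<^sup>2 \<in> \<int>" by auto
qed

section \<open>The integral basis \<open>1\<close>, \<open>quad_omega D\<close>\<close>

lemma square_mod_4: "(t::int)\<^sup>2 mod 4 = (if even t then 0 else 1)"
proof (cases "even t")
  case True
  then obtain k where "t = 2 * k" by (elim evenE)
  then show ?thesis by (simp add: power2_eq_square)
next
  case False
  then obtain k where "t = 2 * k + 1" by (elim oddE)
  then have "t\<^sup>2 = 1 + 4 * (k\<^sup>2 + k)" by (simp add: power2_eq_square algebra_simps)
  then have "t\<^sup>2 mod 4 = 1" by presburger
  then show ?thesis using False by simp
qed

lemma ring_of_ints_cases: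
  fixes D :: int
  assumes D: "squarefree D" "D \<ge> 2" and x: "x \<in> ring_of_ints D"
  obtains a b :: int where "x = of_int a + of_int b * quad_omega D"
proof -
  let ?s = "sqrt (of_int D)"
  from x obtain a b where ab: "a \<in> \<rat>" "b \<in> \<rat>" "x = a + b * ?s" and int: "algebraic_int (a + b * ?s)"
    unfolding ring_of_ints_def quad_field_def by auto
  obtain t where t: "2 * a = of_int t"
    using algebraic_int_trace_norm(1)[OF D ab(1,2) int] by (elim Ints_cases)
  obtain m where m: "a\<^sup>2 - of_int D * b\<^sup>2 = of_int m"
    using algebraic_int_trace_norm(2)[OF D ab(1,2) int] by (elim Ints_cases)
  have sq: "of_int D * (2 * b)\<^sup>2 = of_int (t\<^sup>2 - 4 * m)"
  proof -
    have "of_int D * (2 * b)\<^sup>2 = (2 * a)\<^sup>2 - 4 * (a\<^sup>2 - of_int D * b\<^sup>2)" by (simp add: algebra_simps power2_eq_square)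
    then show ?thesis using t m by simp
  qed
  \<comment> \<open>In lowest terms, the square of the denominator of \<open>2 * b\<close> divides
    the squarefree number \<open>D\<close>.\<close>
  have "2 * b \<in> \<int>"
  proof -
    have "2 * b \<in> \<rat>" using ab(2) by simp
    then obtain k l where kl: "l > 0" "coprime k l" "2 * b = of_int k / of_int l" by (elim Rats_cases')
    then have "real_of_int (D * k\<^sup>2) = of_int ((t\<^sup>2 - 4 * m) * l\<^sup>2)"
      using sq unfolding kl(3) by (simp add: power_divide field_simps)
    then have "D * k\<^sup>2 = (t\<^sup>2 - 4 * m) * l\<^sup>2" by (simp only: of_int_eq_iff)
    then have "l\<^sup>2 dvd D * k\<^sup>2" by simp
    then have "l\<^sup>2 dvd D" using kl(2) by (simp add: coprime_dvd_mult_left_iff coprime_commute)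
    then have "l dvd 1" using squarefreeD[OF D(1)] by blast
    with kl show ?thesis by simp
  qed
  then obtain u where u: "2 * b = of_int u" by (elim Ints_cases)
  have e: "D * u\<^sup>2 = t\<^sup>2 - 4 * m"
    using sq unfolding u by (simp only: of_int_power[symmetric] of_int_mult[symmetric] of_int_eq_iff)
  have "D mod 4 \<noteq> 0"
  proof
    assume "D mod 4 = 0"
    then have "(2::int)\<^sup>2 dvd D" by auto
    then have "(2::int) dvd 1" using squarefreeD[OF D(1)] by blast
    then show False by simp
  qed
  moreover have "D mod 4 \<in> {0, 1, 2, 3}" by auto
  moreover have "D mod 4 * (u\<^sup>2 mod 4) mod 4 = t\<^sup>2 mod 4"
  proof -
    have "D * u\<^sup>2 mod 4 = t\<^sup>2 mod 4" unfolding e by presburger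
    then show ?thesis by (simp add: mod_mult_eq)
  qed
  \<comment> \<open>Squares are \<open>0\<close> or \<open>1\<close> modulo 4. Hence
    \<open>D u^2 = t^2\<close> modulo 4 forces equal parity when \<open>D\<close> is
    \<open>1\<close> modulo 4, and both even when \<open>D\<close> is \<open>2\<close> or
    \<open>3\<close>.\<close>
  ultimately have par: "(even t \<longleftrightarrow> even u) \<and> (D mod 4 \<noteq> 1 \<longrightarrow> even u)"
    unfolding square_mod_4 by (auto split: if_splits)
  show ?thesis
  proof (cases "D mod 4 = 1")
    case True
    from par have "even (t - u)" by simp
    then obtain c where "t - u = 2 * c" by (elim evenE)
    then have "a = of_int c + b" using t u by linarith
    then have "x = of_int c + of_int u * quad_omega D"
      using ab(3) u True by (simp add: quad_omega_def xi_def field_simps)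
    then show ?thesis by (rule that)
  next
    case False
    with par obtain c d where "t = 2 * c" "u = 2 * d" by (auto elim!: evenE)
    with t u have "a = of_int c" "b = of_int d" by auto
    with ab(3) False have "x = of_int c + of_int d * quad_omega D"
      by (simp add: quad_omega_def xi_def)
    then show ?thesis by (rule that)
  qed
qed

lemma quad_omega_combination:
  fixes D a b :: int
  assumes "squarefree D" "D \<ge> 2"
  shows "of_int a + of_int b * quad_omega D \<in> ring_of_ints D"
    and "quad_conj D (of_int a + of_int b * quad_omega D) = of_int a - of_int b * xi D"
proof -
  let ?s = "sqrt (of_int D)"
  obtain p q :: real where pq: "p \<in> \<rat>" "q \<in> \<rat>" "quad_omega D = p + q * ?s" "xi D = q * ?s - p"
  proof (cases "D mod 4 = 1")
    case True
    then show ?thesis by (intro that[of "1/2" "1/2"]) (auto simp: quad_omega_def xi_def field_simps)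
  next
    case False
    then show ?thesis by (intro that[of 0 1]) (auto simp: quad_omega_def xi_def)
  qed
  have e: "of_int a + of_int b * quad_omega D = (of_int a + of_int b * p) + (of_int b * q) * ?s"
    by (simp add: pq algebra_simps)
  have r: "of_int a + of_int b * p \<in> \<rat>" "of_int b * q \<in> \<rat>" using pq by auto
  \<comment> \<open>As \<open>- xi D\<close> is the conjugate of \<open>quad_omega D\<close>, the
    trace of \<open>quad_omega D\<close> is \<open>d\<close> and its norm is
    \<open>- k\<close>.\<close>
  obtain d k :: int where dk: "quad_omega D = xi D + of_int d" "quad_omega D * xi D = of_int k"
  proof (cases "D mod 4 = 1")
    case True
    then have "D = 4 * (D div 4) + 1" by presburger
    then have "?s * ?s = 4 * of_int (D div 4) + 1"
      using arg_cong[of D _ real_of_int] assms(2) by simp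
    with True show ?thesis
      by (intro that[of 1 "D div 4"]) (auto simp: quad_omega_def xi_def field_simps)
  next
    case False
    with assms(2) show ?thesis by (intro that[of 0 D]) (auto simp: quad_omega_def xi_def)
  qed
  have "algebraic_int (of_int a + of_int b * quad_omega D)"
  proof (rule algebraic_int.intros)
    \<comment> \<open>The monic quadratic formed from the norm and the trace of
      \<open>a + b * quad_omega D\<close>.\<close>
    let ?p = "[:of_int (a\<^sup>2 + a * b * d - b\<^sup>2 * k), - of_int (2 * a + b * d), 1:] :: real poly"
    show "\<forall>i. coeff ?p i \<in> \<int>"
      by (auto simp: coeff_pCons split: nat.splits)
    show "poly ?p (of_int a + of_int b * quad_omega D) = 0"
      unfolding of_int_diff of_int_mult dk(2)[symmetric]
      by (simp add: dk(1) power2_eq_square algebra_simps)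
  qed simp
  moreover have "of_int a + of_int b * quad_omega D \<in> quad_field D"
    unfolding e quad_field_def using r by blast
  ultimately show "of_int a + of_int b * quad_omega D \<in> ring_of_ints D"
    by (simp add: ring_of_ints_def)
  show "quad_conj D (of_int a + of_int b * quad_omega D) = of_int a - of_int b * xi D"
    unfolding e quad_conj_eq[OF assms r] by (simp add: pq algebra_simps)
qed

lemma xi_irrational:
  assumes "squarefree D" "D \<ge> 2"
  shows "xi D \<notin> \<rat>"
proof
  assume "xi D \<in> \<rat>"
  moreover from this have "2 * xi D + 1 \<in> \<rat>" by simp
  moreover have "sqrt (of_int D) = (if D mod 4 = 1 then 2 * xi D + 1 else xi D)"
    by (simp add: xi_def field_simps)
  ultimately have "sqrt (of_int D) \<in> \<rat>" by presburger
  with sqrt_squarefree_irrational[OF assms] show False by simp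
qed

section \<open>Partitions in a cone of integer pairs\<close>

text \<open>Totally positive integers in coordinates for the basis \<open>1\<close>,
  \<open>\<omega>\<close>. Keeping \<open>\<omega>\<close> and \<open>\<xi>\<close> as real
  parameters frees the counting from field arithmetic.\<close>

definition cone :: "real \<Rightarrow> real \<Rightarrow> (int \<times> int) set" where
  "cone \<omega> \<xi> = {(a, b). of_int a + of_int b * \<omega> > 0 \<and> of_int a - of_int b * \<xi> > 0}"

definition cone_partitions :: "real \<Rightarrow> real \<Rightarrow> int \<times> int \<Rightarrow> (int \<times> int) multiset set" where
  "cone_partitions \<omega> \<xi> v = {M. M \<noteq> {#} \<and> set_mset M \<subseteq> cone \<omega> \<xi> \<and> sum_mset M = v}"

text \<open>The coordinate map is additive, injective because \<open>xi D\<close> is irrational, and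
  maps the cone onto the totally positive integers; applied part by part it is a bijection of
  partitions.\<close>

lemma num_partitions_eq_card_cone_partitions:
  fixes D a b :: int
  assumes D: "squarefree D" "D \<ge> 2"
  shows "num_partitions D (of_int a + of_int b * quad_omega D)
    = card (cone_partitions (quad_omega D) (xi D) (a, b))"
proof -
  define e :: "int \<times> int \<Rightarrow> real" where "e = (\<lambda>(a, b). of_int a + of_int b * quad_omega D)"
  have inj: "inj e"
  proof (rule injI)
    fix x y assume "e x = e y"
    moreover obtain a b c d where xy: "x = (a, b)" "y = (c, d)" by fastforce
    ultimately have eq: "of_int a + of_int b * quad_omega D = of_int c + of_int d * quad_omega D"
      by (simp add: e_def)
    then have "of_int a - of_int b * xi D = of_int c - of_int d * xi D"
      using quad_omega_combination(2)[OF D] by metis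
    then have *: "(of_int b - of_int d) * xi D = of_int a - of_int c" by (simp add: algebra_simps)
    have "b = d"
    proof (rule ccontr)
      assume "b \<noteq> d"
      then have "xi D = (of_int a - of_int c) / (of_int b - of_int d)" using * by (simp add: field_simps)
      also have "\<dots> \<in> \<rat>" by simp
      finally show False using xi_irrational[OF D] by simp
    qed
    with * xy show "x = y" by simp
  qed
  have img: "tot_pos_ints D = e ` cone (quad_omega D) (xi D)"
  proof (intro equalityI subsetI)
    fix x assume x: "x \<in> tot_pos_ints D"
    then have "x \<in> ring_of_ints D" by (simp add: tot_pos_ints_def)
    then obtain c d where cd: "x = of_int c + of_int d * quad_omega D"
      using ring_of_ints_cases[OF D] by blast
    then have "(c, d) \<in> cone (quad_omega D) (xi D)" "x = e (c, d)"
      using x quad_omega_combination[OF D] by (auto simp: tot_pos_ints_def cone_def e_def)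
    then show "x \<in> e ` cone (quad_omega D) (xi D)" by blast
  next
    fix x assume "x \<in> e ` cone (quad_omega D) (xi D)"
    then show "x \<in> tot_pos_ints D"
      using quad_omega_combination[OF D] by (auto simp: tot_pos_ints_def cone_def e_def)
  qed
  have sum: "sum_mset (image_mset e N) = e (sum_mset N)" for N
    by (induction N) (auto simp: e_def zero_prod_def algebra_simps split: prod.splits)
  have "partitions_of D (e (a, b)) = image_mset e ` cone_partitions (quad_omega D) (xi D) (a, b)"
  proof (intro equalityI subsetI)
    fix M assume M: "M \<in> partitions_of D (e (a, b))"
    define N where "N = image_mset (inv e) M"
    have "\<And>x. x \<in># M \<Longrightarrow> e (inv e x) = x"
      using M img by (auto simp: partitions_of_def intro!: f_inv_into_f)
    then have MN: "M = image_mset e N"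
      unfolding N_def by (simp add: multiset.map_comp o_def cong: multiset.map_cong)
    have "N \<in> cone_partitions (quad_omega D) (xi D) (a, b)"
      using M inj by (auto simp: MN sum cone_partitions_def partitions_of_def img inj_image_subset_iff dest: injD)
    with MN show "M \<in> image_mset e ` cone_partitions (quad_omega D) (xi D) (a, b)" by blast
  next
    fix M assume "M \<in> image_mset e ` cone_partitions (quad_omega D) (xi D) (a, b)"
    then show "M \<in> partitions_of D (e (a, b))"
      by (auto simp: cone_partitions_def partitions_of_def img sum intro!: imageI)
  qed
  moreover have "inj (image_mset e)" using inj by (rule multiset.inj_map)
  ultimately have "card (partitions_of D (e (a, b))) = card (cone_partitions (quad_omega D) (xi D) (a, b))"
    by (metis card_image inj_on_subset subset_UNIV)
  then show ?thesis by (simp add: num_partitions_def e_def)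
qed

section \<open>Constraints on the parts of a partition\<close>

lemma cone_sum_conjugate_nonneg:
  assumes "set_mset M \<subseteq> cone \<omega> \<xi>"
  shows "of_int (fst (sum_mset M)) - of_int (snd (sum_mset M)) * \<xi> \<ge> 0"
  using assms by (induction M) (auto simp: cone_def algebra_simps)

text \<open>The remaining parts have nonnegative conjugate sum. This excludes parts whose conjugate
  is too large.\<close>

lemma cone_partitions_part_le:
  assumes "set_mset M \<subseteq> cone \<omega> \<xi>" "(a, b) \<in># M"
  shows "of_int a - of_int b * \<xi> \<le> of_int (fst (sum_mset M)) - of_int (snd (sum_mset M)) * \<xi>"
proof -
  from assms(2) obtain N where N: "M = add_mset (a, b) N" by (metis mset_add)
  with cone_sum_conjugate_nonneg[of N \<omega> \<xi>] assms(1) show ?thesis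
    by (simp add: algebra_simps)
qed

lemma snd_nonneg_sum:
  assumes "\<forall>x\<in>#M. snd x \<ge> 0"
  shows "snd (sum_mset M) \<ge> (0::int)"
  using assms by (induction M) auto

lemma snd_sum_eq_0:
  assumes "\<forall>x\<in>#M. snd x \<ge> 0" "snd (sum_mset M) = (0::int)"
  shows "\<forall>x\<in>#M. snd x = 0"
  using assms
proof (induction M)
  case (add x M)
  then show ?case using snd_nonneg_sum[of M] by auto
qed auto

lemma snd_pos_part:
  assumes "snd (sum_mset M) > (0::int)"
  obtains x N where "M = add_mset x N" "snd x > 0"
proof -
  have "\<exists>x\<in>#M. snd x > 0"
    using assms by (induction M) fastforce+
  then show ?thesis using that by (metis mset_add)
qed

text \<open>Removing a part lowers the total by at least one, so each total reduces to smaller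
  ones.\<close>

lemma positive_integers_partition_cases:
  fixes M :: "(int \<times> int) multiset"
  assumes "\<forall>x\<in>#M. snd x = 0 \<and> fst x \<ge> 1"
  shows "fst (sum_mset M) \<ge> 0"
    and "fst (sum_mset M) = 0 \<Longrightarrow> M = {#}"
    and "fst (sum_mset M) = 1 \<Longrightarrow> M = {#(1, 0)#}"
    and "fst (sum_mset M) = 2 \<Longrightarrow> M \<in> {{#(2, 0)#}, {#(1, 0), (1, 0)#}}"
proof -
  have nonneg: "fst (sum_mset M) \<ge> 0" if "\<forall>x\<in>#M. snd x = 0 \<and> fst x \<ge> 1" for M :: "(int \<times> int) multiset"
    using that by (induction M) auto
  have zero: "M = {#}" if "\<forall>x\<in>#M. snd x = 0 \<and> fst x \<ge> 1" "fst (sum_mset M) \<le> 0" for M :: "(int \<times> int) multiset"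
    using that nonneg by (cases M) fastforce+
  have one: "M = {#(1, 0)#}" if M: "\<forall>x\<in>#M. snd x = 0 \<and> fst x \<ge> 1" "fst (sum_mset M) = 1" for M :: "(int \<times> int) multiset"
  proof (cases M)
    case (add x N)
    then have "N = {#}" using M zero[of N] by auto
    then show ?thesis using add M by (auto simp: prod_eq_iff)
  qed (use M in auto)
  show "fst (sum_mset M) \<ge> 0" "fst (sum_mset M) = 0 \<Longrightarrow> M = {#}"
    "fst (sum_mset M) = 1 \<Longrightarrow> M = {#(1, 0)#}"
    using nonneg[OF assms] zero[OF assms] one[OF assms] by auto
  assume two: "fst (sum_mset M) = 2"
  show "M \<in> {{#(2, 0)#}, {#(1, 0), (1, 0)#}}"
  proof (cases M)
    case (add x N)
    then have N: "\<forall>x\<in>#N. snd x = 0 \<and> fst x \<ge> 1" and x: "snd x = 0" "fst x \<ge> 1"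
      and s: "fst x + fst (sum_mset N) = 2" using assms two by auto
    then consider "fst x = 1" "fst (sum_mset N) = 1" | "fst x = 2" "fst (sum_mset N) = 0"
      using nonneg[OF N] by linarith
    then show ?thesis
    proof cases
      case 1
      then show ?thesis using add x one[OF N] by (cases x) auto
    next
      case 2
      then show ?thesis using add x zero[OF N] by (cases x) auto
    qed
  qed (use two in auto)
qed

text \<open>The assumptions on \<open>n\<close> say that it is the ceiling of a non-integral
  \<open>\<xi>\<close>. The bound \<open>xi_d\<close> says that \<open>(n + 2, 1)\<close>, with
  conjugate \<open>n + 2 - \<xi>\<close>, lies below the threshold \<open>n + d + \<xi>\<close> for
  negative second coordinates.\<close>

locale quadratic_cone =
  fixes \<omega> \<xi> :: real and n d :: int
  assumes omega: "\<omega> = \<xi> + of_int d" and d: "d \<ge> 0" and xi_pos: "\<xi> > 0" and xi_d: "2 * \<xi> + of_int d > 2"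
    and n: "of_int n - 1 < \<xi>" "\<xi> < of_int n"
begin

section \<open>Least elements of the cone and the counts\<close>

lemma cone_snd_0: "(a, 0) \<in> cone \<omega> \<xi> \<longleftrightarrow> a \<ge> 1"
  by (auto simp: cone_def)

lemma cone_snd_1: "(a, 1) \<in> cone \<omega> \<xi> \<longleftrightarrow> a \<ge> n"
  using n omega d xi_pos by (auto simp: cone_def; linarith)

text \<open>The hypothesis and \<open>n - 1 < \<xi>\<close> place \<open>2 * \<xi>\<close> strictly
  between \<open>2 * n - 2\<close> and \<open>2 * n - 1\<close>.\<close>

lemma cone_snd_2:
  assumes "of_int n - \<xi> > 1 / 2"
  shows "(a, 2) \<in> cone \<omega> \<xi> \<longleftrightarrow> a \<ge> 2 * n - 1"
  using n omega d xi_pos assms by (auto simp: cone_def; linarith)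

text \<open>Here \<open>a > \<omega> > n + d - 1\<close>, so \<open>a\<close> is at least
  \<open>n + d\<close>, while \<open>- b * \<xi>\<close> is at least \<open>\<xi>\<close>. Equality
  holds at \<open>(n + d, -1)\<close>.\<close>

lemma cone_snd_neg:
  assumes "(a, b) \<in> cone \<omega> \<xi>" "b < 0"
  shows "of_int a - of_int b * \<xi> \<ge> of_int (n + d) + \<xi>"
proof -
  have "of_int b \<le> (-1::real)" using assms(2) by linarith
  moreover have "\<omega> > 0" using omega d xi_pos by linarith
  ultimately have "of_int b * \<omega> \<le> (-1) * \<omega>" "of_int b * \<xi> \<le> (-1) * \<xi>"
    using xi_pos by (intro mult_right_mono; simp)+
  moreover from this have "of_int a > \<omega>" using assms(1) by (simp add: cone_def)
  then have "a \<ge> n + d" using n omega by linarith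
  ultimately show ?thesis by linarith
qed

lemma snd_nonneg:
  assumes "set_mset M \<subseteq> cone \<omega> \<xi>"
    "of_int (fst (sum_mset M)) - of_int (snd (sum_mset M)) * \<xi> < of_int (n + d) + \<xi>"
  shows "\<forall>x\<in>#M. snd x \<ge> 0"
proof
  fix x assume x: "x \<in># M"
  obtain a b where ab: "x = (a, b)" by fastforce
  show "snd x \<ge> 0"
  proof (rule ccontr)
    assume "\<not> snd x \<ge> 0"
    then show False
      using cone_snd_neg[of a b] cone_partitions_part_le[OF assms(1), of a b] x ab assms by auto
  qed
qed

text \<open>The empty multiset is included because this is applied to what is left after removing a
  part.\<close>

lemma snd_eq_0_cases:
  assumes "set_mset M \<subseteq> cone \<omega> \<xi>" "\<forall>x\<in>#M. snd x \<ge> 0" "snd (sum_mset M) = 0"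
    and "fst (sum_mset M) \<le> 2"
  shows "fst (sum_mset M) = 0 \<and> M = {#} \<or> fst (sum_mset M) = 1 \<and> M = {#(1, 0)#} \<or>
    fst (sum_mset M) = 2 \<and> M \<in> {{#(2, 0)#}, {#(1, 0), (1, 0)#}}"
proof -
  have *: "\<forall>x\<in>#M. snd x = 0 \<and> fst x \<ge> 1"
  proof
    fix x assume "x \<in># M"
    moreover from this have "snd x = 0" using snd_sum_eq_0[OF assms(2,3)] by blast
    ultimately show "snd x = 0 \<and> fst x \<ge> 1" using assms(1) cone_snd_0[of "fst x"] by (cases x) auto
  qed
  have "fst (sum_mset M) \<in> {0, 1, 2}"
    using positive_integers_partition_cases(1)[OF *] assms(4) by auto
  then show ?thesis using positive_integers_partition_cases(2-)[OF *] by blast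
qed

text \<open>Exactly one part has second coordinate 1. Its first coordinate is at least
  \<open>n\<close>, so the other parts form a partition of 0, 1 or 2 into positive integers.\<close>

lemma snd_eq_1_cases:
  assumes "set_mset M \<subseteq> cone \<omega> \<xi>" "\<forall>x\<in>#M. snd x \<ge> 0" "snd (sum_mset M) = 1"
    and "fst (sum_mset M) \<le> n + 2"
  shows "fst (sum_mset M) = n \<and> M = {#(n, 1)#} \<or>
    fst (sum_mset M) = n + 1 \<and> M \<in> {{#(n + 1, 1)#}, {#(n, 1), (1, 0)#}} \<or>
    fst (sum_mset M) = n + 2 \<and>
      M \<in> {{#(n + 2, 1)#}, {#(n + 1, 1), (1, 0)#}, {#(n, 1), (2, 0)#}, {#(n, 1), (1, 0), (1, 0)#}}"
proof -
  obtain x N where M: "M = add_mset x N" "snd x > 0"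
    using snd_pos_part[of M] assms(3) by (auto simp del: sum_mset.add_mset)
  obtain a b where x: "x = (a, b)" by fastforce
  have N: "set_mset N \<subseteq> cone \<omega> \<xi>" "\<forall>x\<in>#N. snd x \<ge> 0" using M assms by auto
  have b: "b = 1" "snd (sum_mset N) = 0" using M x assms(3) snd_nonneg_sum[OF N(2)] by auto
  have a: "a \<ge> n" using M x b assms(1) cone_snd_1[of a] by auto
  have s: "fst (sum_mset M) = a + fst (sum_mset N)" using M x by simp
  have "fst (sum_mset N) \<le> 2" using a s assms(4) by simp
  then consider "fst (sum_mset N) = 0" "N = {#}" | "fst (sum_mset N) = 1" "N = {#(1, 0)#}"
    | "fst (sum_mset N) = 2" "N \<in> {{#(2, 0)#}, {#(1, 0), (1, 0)#}}"
    using snd_eq_0_cases[OF N b(2)] by blast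
  then show ?thesis
  proof cases
    case 1
    then have "a \<in> {n, n + 1, n + 2}" using a s assms(4) by auto
    then show ?thesis using 1 s M x b by auto
  next
    case 2
    then have "a \<in> {n, n + 1}" using a s assms(4) by auto
    then show ?thesis using 2 s M x b by auto
  next
    case 3
    then have "a = n" using a s assms(4) by auto
    then show ?thesis using 3 s M x b by auto
  qed
qed

lemma card_cone_partitions_4: "card (cone_partitions \<omega> \<xi> (n + 2, 1)) = 4"
proof -
  have "cone_partitions \<omega> \<xi> (n + 2, 1) =
    {{#(n + 2, 1)#}, {#(n + 1, 1), (1, 0)#}, {#(n, 1), (2, 0)#}, {#(n, 1), (1, 0), (1, 0)#}}"
    (is "_ = ?R")
  proof (intro equalityI subsetI)
    fix M assume "M \<in> cone_partitions \<omega> \<xi> (n + 2, 1)"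
    then have M: "set_mset M \<subseteq> cone \<omega> \<xi>" "sum_mset M = (n + 2, 1)"
      by (auto simp: cone_partitions_def)
    \<comment> \<open>The required bound \<open>n + 2 - \<xi> < n + d + \<xi>\<close> is exactly
      \<open>xi_d\<close>.\<close>
    have "\<forall>x\<in>#M. snd x \<ge> 0" by (rule snd_nonneg[OF M(1)]) (use M xi_d in simp)
    from snd_eq_1_cases[OF M(1) this] show "M \<in> ?R" using M(2) by auto
  next
    fix M assume "M \<in> ?R"
    then show "M \<in> cone_partitions \<omega> \<xi> (n + 2, 1)"
      by (auto simp: cone_partitions_def cone_snd_0 cone_snd_1)
  qed
  then show ?thesis by (simp add: add_eq_conv_diff)
qed

text \<open>Four partitions have a part of second coordinate 2, which exceeds the least possible
  \<open>2 * n - 1\<close> by 2, 1 or 0; the other two have two parts of second coordinate 1, with a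
  total excess of 1 or 0 over \<open>n\<close> each.\<close>

lemma card_cone_partitions_6:
  assumes half: "of_int n - \<xi> > 1 / 2"
  shows "card (cone_partitions \<omega> \<xi> (2 * n + 1, 2)) = 6"
proof -
  have "cone_partitions \<omega> \<xi> (2 * n + 1, 2) =
    {{#(2 * n + 1, 2)#}, {#(2 * n, 2), (1, 0)#}, {#(2 * n - 1, 2), (2, 0)#},
     {#(2 * n - 1, 2), (1, 0), (1, 0)#}, {#(n + 1, 1), (n, 1)#}, {#(n, 1), (n, 1), (1, 0)#}}"
    (is "_ = ?R")
  proof (intro equalityI subsetI)
    fix M assume "M \<in> cone_partitions \<omega> \<xi> (2 * n + 1, 2)"
    then have M: "set_mset M \<subseteq> cone \<omega> \<xi>" "sum_mset M = (2 * n + 1, 2)"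
      by (auto simp: cone_partitions_def)
    \<comment> \<open>The required bound amounts to \<open>n + 1 < 3 * \<xi> + d\<close>, the sum of
      \<open>n - 1 < \<xi>\<close> and \<open>xi_d\<close>.\<close>
    have "\<forall>x\<in>#M. snd x \<ge> 0" by (rule snd_nonneg[OF M(1)]) (use M xi_d n in simp)
    moreover obtain x N where MN: "M = add_mset x N" "snd x > 0"
      using snd_pos_part[of M] M(2) by auto
    moreover obtain a b where x: "x = (a, b)" by fastforce
    ultimately have N: "set_mset N \<subseteq> cone \<omega> \<xi>" "\<forall>x\<in>#N. snd x \<ge> 0" and ab: "(a, b) \<in> cone \<omega> \<xi>" "b > 0"
      using M(1) by auto
    have s: "fst (sum_mset N) = 2 * n + 1 - a" "snd (sum_mset N) = 2 - b"
      using M(2) MN x by (auto simp: prod_eq_iff)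
    then consider "b = 1" "snd (sum_mset N) = 1" | "b = 2" "snd (sum_mset N) = 0"
      using snd_nonneg_sum[OF N(2)] ab(2) by force
    then show "M \<in> ?R"
    proof cases
      case 1
      with ab have a: "a \<ge> n" by (simp add: cone_snd_1)
      with s have "fst (sum_mset N) \<le> n + 2" by simp
      from snd_eq_1_cases[OF N 1(2) this] show ?thesis
        using a s 1 MN x by auto
    next
      case 2
      with ab have a: "a \<ge> 2 * n - 1" by (simp add: cone_snd_2[OF half])
      with s have "fst (sum_mset N) \<le> 2" by simp
      from snd_eq_0_cases[OF N 2(2) this] have "fst (sum_mset N) = 0 \<and> a = 2 * n + 1 \<and> N = {#} \<or>
        a = 2 * n \<and> N = {#(1, 0)#} \<or> a = 2 * n - 1 \<and> N \<in> {{#(2, 0)#}, {#(1, 0), (1, 0)#}}"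
        using s by auto
      then show ?thesis using 2 MN x by auto
    qed
  next
    fix M assume "M \<in> ?R"
    then show "M \<in> cone_partitions \<omega> \<xi> (2 * n + 1, 2)"
      by (auto simp: cone_partitions_def cone_snd_0 cone_snd_1 cone_snd_2[OF half])
  qed
  then show ?thesis by (simp add: add_eq_conv_diff)
qed

end

section \<open>Specialising the cone counts to the quadratic field\<close>

theorem theorem1p4:
  fixes D :: int
  assumes "D \<ge> 2" and "squarefree D"
  shows "(\<exists>\<alpha> \<in> tot_pos_ints D. num_partitions D \<alpha> = 4) \<and>
    (of_int \<lceil>xi D\<rceil> - xi D > 1 / 2 \<longrightarrow> (\<exists>\<alpha> \<in> tot_pos_ints D. num_partitions D \<alpha> = 6))"
proof -
  let ?n = "\<lceil>xi D\<rceil>" and ?d = "if D mod 4 = 1 then 1 else 0 :: int"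
  interpret quadratic_cone "quad_omega D" "xi D" ?n ?d
  proof
    \<comment> \<open>If \<open>D\<close> is \<open>1\<close> modulo 4, then
      \<open>2 * xi D + 1\<close> is the square root of \<open>D\<close>, and \<open>D\<close> is at
      least 5. Otherwise \<open>2 * xi D\<close> is twice a square root exceeding 1.\<close>
    have large: "sqrt (of_int D) > 2" if "D mod 4 = 1"
    proof -
      have "D \<ge> 5" using that assms(1) by presburger
      then show ?thesis by (intro real_less_rsqrt) simp
    qed
    have "sqrt (of_int D) > 1" using assms(1) by simp
    with large show "xi D > 0" "2 * xi D + of_int ?d > 2" by (auto simp: xi_def)
    have "xi D \<noteq> of_int ?n" using xi_irrational[OF assms(2,1)] by (metis Rats_of_int)
    then show "of_int ?n - 1 < xi D" "xi D < of_int ?n" by linarith+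
  qed (auto simp: quad_omega_def)
  have mem: "of_int a + of_int b * quad_omega D \<in> tot_pos_ints D" if "(a, b) \<in> cone (quad_omega D) (xi D)" for a b
    using that quad_omega_combination[OF assms(2,1)] by (simp add: tot_pos_ints_def cone_def)
  have "(?n + 2, 1) \<in> cone (quad_omega D) (xi D)" by (simp add: cone_snd_1)
  moreover have "(2 * ?n + 1, 2) \<in> cone (quad_omega D) (xi D)" if "of_int ?n - xi D > 1 / 2"
    using that by (simp add: cone_snd_2)
  ultimately show ?thesis
    using mem num_partitions_eq_card_cone_partitions[OF assms(2,1)]
      card_cone_partitions_4 card_cone_partitions_6 by metis
qed

end
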